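(* Let $k\ge 0$ be an integer. Every graph $G$ with treewidth $k$ has a tree-decomposition with width at most $14k+13$ such that each vertex $v\in V(G)$ has spread at most $\deg_G(v)+1$.
   Context: Graphs are simple, undirected and finite. For a non-empty tree $T$, a $T$-decomposition of a graph $G$ is a collection $(B_x:x\in V(T))$ of subsets $B_x\subseteq V(G)$ (bags) such that for each edge $vw\in E(G)$ some bag contains both $v$ and $w$, and for each $v\in V(G)$ the set $\{x\in V(T):v\in B_x\}$ induces a non-empty connected subtree of $T$. A tree-decomposition is a $T$-decomposition for some tree $T$. Its width is $\max_x|B_x|-1$; the treewidth of $G$ is the minimum width of a tree-decomposition of $G$. The spread of a vertex $v$ in a tree-decomposition $(B_x:x\in V(T))$ is the number of nodes $x\in V(T)$ with $v\in B_x$. *)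

theory Defs
  imports "Graph_Theory.Graph_Theory"
begin

text \<open>
  Finite simple undirected graphs are the \<^locale>\<open>pair_graph\<close>s of the library: finite symmetric
  loop-free digraphs whose arcs are ordered pairs, so that the edge \<open>vw\<close> is the pair of arcs
  \<open>(v, w)\<close>, \<open>(w, v)\<close>.  Accordingly the degree of a vertex is its out-degree.
\<close>

abbreviation vert_degree :: "'a pair_pre_digraph \<Rightarrow> 'a \<Rightarrow> nat" where
  "vert_degree G v \<equiv> out_degree (with_proj G) v"

text \<open>
  The library's \<^const>\<open>tree\<close> forbids directed cycles only: it rejects every symmetric digraph with
  an arc (because of the closed walk \<open>a, b, a\<close>) and accepts acyclic orientations of undirected
  cycles.  In a symmetric loop-free digraph, the cycles of the underlying undirected graph are the
  directed cycles of length at least 3.  Note that \<^const>\<open>Digraph_Component.connected\<close> includes non-emptiness.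
\<close>

definition undirected_tree :: "'a pair_pre_digraph \<Rightarrow> bool" where
  "undirected_tree T \<longleftrightarrow> pair_graph T \<and> Digraph_Component.connected (with_proj T) \<and>
     \<not> (\<exists>p. pre_digraph.cycle (with_proj T) p \<and> length p \<ge> 3)"

definition tree_decomposition ::
    "'a pair_pre_digraph \<Rightarrow> 'b pair_pre_digraph \<Rightarrow> ('b \<Rightarrow> 'a set) \<Rightarrow> bool" where
  "tree_decomposition G T B \<longleftrightarrow> undirected_tree T \<and>
     (\<forall>x\<in>pverts T. B x \<subseteq> pverts G) \<and>
     (\<forall>(v, w)\<in>parcs G. \<exists>x\<in>pverts T. v \<in> B x \<and> w \<in> B x) \<and>
     (\<forall>v\<in>pverts G. Digraph_Component.connected (with_proj T \<restriction> {x \<in> pverts T. v \<in> B x}))"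

text \<open>Integer-valued, since the width is \<open>-1\<close> if all bags are empty.\<close>

definition width :: "'b pair_pre_digraph \<Rightarrow> ('b \<Rightarrow> 'a set) \<Rightarrow> int" where
  "width T B = int (Max ((\<lambda>x. card (B x)) ` pverts T)) - 1"

text \<open>
  Nodes of trees are natural numbers here; this is no restriction, as trees are finite.
\<close>

definition treewidth :: "'a pair_pre_digraph \<Rightarrow> int" where
  "treewidth G = (LEAST w. \<exists>(T :: nat pair_pre_digraph) B. tree_decomposition G T B \<and> width T B = w)"

definition spread :: "'b pair_pre_digraph \<Rightarrow> ('b \<Rightarrow> 'a set) \<Rightarrow> 'a \<Rightarrow> nat" where
  "spread T B v = card {x \<in> pverts T. v \<in> B x}"

text \<open>
  \<open>LEAST\<close> on the integers is meaningful only if a least element exists; the following facts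
  confirm that it does.
\<close>

lemma tree_decomposition_trivial:
  assumes "pair_graph G"
  shows "tree_decomposition G \<lparr>pverts = {x}, parcs = {}\<rparr> (\<lambda>_. pverts G)"
proof -
  let ?T = "\<lparr>pverts = {x}, parcs = {}\<rparr> :: 'b pair_pre_digraph"
  interpret G: pair_graph G by (fact assms)
  have "pair_graph ?T"
    by unfold_locales (simp_all add: symmetric_def sym_def)
  moreover have con: "connected H" if "verts H = {x}" for H :: "('b, 'b \<times> 'b) pre_digraph"
    using that by (auto simp: connected_def strongly_connected_def mk_symmetric_def reachable_def)
  moreover have "\<not> (pre_digraph.cycle (with_proj ?T) p \<and> length p \<ge> 3)" for p
    by (auto simp: pre_digraph.cycle_def pre_digraph.awalk_def)
  ultimately have "undirected_tree ?T"
    by (auto simp: undirected_tree_def)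
  then show ?thesis
    using G.in_arcsD1 G.in_arcsD2 by (auto simp: tree_decomposition_def intro!: con)
qed

lemma treewidth_minimum:
  assumes "pair_graph G"
  shows treewidth_attained:
      "\<exists>(T :: nat pair_pre_digraph) B. tree_decomposition G T B \<and> width T B = treewidth G"
    and treewidth_le:
      "tree_decomposition G (T :: nat pair_pre_digraph) B \<Longrightarrow> treewidth G \<le> width T B"
proof -
  define P where "P w \<longleftrightarrow> (\<exists>(T :: nat pair_pre_digraph) B. tree_decomposition G T B \<and> width T B = w)"
    for w
  have lower: "w \<ge> -1" if "P w" for w
    using that by (auto simp: P_def width_def)
  define T0 where "T0 = (\<lparr>pverts = {0}, parcs = {}\<rparr> :: nat pair_pre_digraph)"
  define w0 where "w0 = width T0 (\<lambda>_. pverts G)"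
  have "tree_decomposition G T0 (\<lambda>_. pverts G)"
    unfolding T0_def by (rule tree_decomposition_trivial[OF assms])
  then have "P w0"
    unfolding P_def w0_def by (intro exI conjI) (assumption, rule refl)
  define n where "n = (LEAST n. P (int n - 1))"
  have "P (int (nat (w0 + 1)) - 1)"
    using \<open>P w0\<close> lower[OF \<open>P w0\<close>] by simp
  then have n: "P (int n - 1)"
    unfolding n_def by (rule LeastI)
  have min: "int n - 1 \<le> w" if "P w" for w
  proof -
    have "P (int (nat (w + 1)) - 1)"
      using that lower[OF that] by simp
    then have "n \<le> nat (w + 1)"
      unfolding n_def by (rule Least_le)
    then show ?thesis
      using lower[OF that] by linarith
  qed
  have tw: "treewidth G = int n - 1"
    unfolding treewidth_def using n min by (intro Least_equality) (auto simp: P_def)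
  show "\<exists>(T :: nat pair_pre_digraph) B. tree_decomposition G T B \<and> width T B = treewidth G"
    using n by (simp add: tw P_def)
  show "treewidth G \<le> width T B" if "tree_decomposition G T B" for T :: "nat pair_pre_digraph" and B
    using min[of "width T B"] that by (auto simp: tw P_def)
qed

end

theory Submission
  imports Defs "HOL-Library.Nat_Bijection"
begin

text \<open>
  Put \<open>m = 2(k + 1)\<close>.  Removing two bags \<open>X\<close> of a width-\<open>k\<close> tree-decomposition splits any given set of
  vertices into parts of at most a third, with no edges between the parts.  One proves more
  generally: if \<open>S\<close> consists of at most \<open>3m\<close> non-isolated vertices, then there is a decomposition
  with bags of size at most \<open>7m\<close>, root bag containing \<open>S\<close>, and spread at most \<open>deg v\<close> for \<open>v \<in> S\<close>
  and at most \<open>deg v + 1\<close> otherwise.  To this end, let \<open>S'\<close> be \<open>S\<close> together with one neighbour of each of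
  its vertices (size at most \<open>6m\<close>), let \<open>X\<close> split \<open>S'\<close> into thirds, and take \<open>R = S' \<union> X\<close> as root bag.
  Recurse on each part, with the edges that are not inside \<open>R\<close>, passing on as new \<open>S\<close> only those vertices
  of \<open>R\<close> that still have an edge into the part; these are at most \<open>2m + m\<close>.  Every vertex of \<open>S\<close>
  has lost an edge to the root bag, which pays for its occurrence there.
\<close>

subsection \<open>Undirected trees\<close>

text \<open>Connectedness is defined through the symmetric closure. The arcs of \<open>T\<close> are
  already symmetric, so this closure adds nothing, and reachability reduces to the reflexive
  transitive closure of \<open>Restr (parcs T) U\<close>, the form used from here on.\<close>

lemma connected_induce_iff:
  assumes "pair_graph T" and "U \<subseteq> pverts T"
  shows "Digraph_Component.connected (with_proj T \<restriction> U) \<longleftrightarrow>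
    U \<noteq> {} \<and> (\<forall>u\<in>U. \<forall>v\<in>U. (u, v) \<in> (Restr (parcs T) U)\<^sup>*)"
proof -
  interpret T: pair_graph T by fact
  let ?M = "mk_symmetric (with_proj T \<restriction> U)"
  have "symmetric (with_proj T)" ..
  then have arcs: "parcs ?M = Restr (parcs T) U" 
    by (auto simp: parcs_mk_symmetric induce_subgraph_def symmetric_def dest: symD)
  have verts: "pverts ?M = U"
    by simp
  interpret M: pair_wf_digraph ?M
    by unfold_locales (auto simp: arcs verts)
  have "u \<rightarrow>\<^sup>*\<^bsub>?M\<^esub> v \<longleftrightarrow> (u, v) \<in> (Restr (parcs T) U)\<^sup>*" if "u \<in> U" "v \<in> U" for u v
    using M.reachable_conv[of u v] that by (auto simp: arcs)
  then show ?thesis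
    by (auto simp: connected_def strongly_connected_def)
qed

lemma connected_iff:
  assumes "pair_graph T"
  shows "Digraph_Component.connected (with_proj T) \<longleftrightarrow>
    pverts T \<noteq> {} \<and> (\<forall>u\<in>pverts T. \<forall>v\<in>pverts T. (u, v) \<in> (parcs T)\<^sup>*)"
proof -
  interpret T: pair_graph T by fact
  have "with_proj T \<restriction> pverts T = with_proj T" "Restr (parcs T) (pverts T) = parcs T"
    by (auto simp: with_proj_def induce_subgraph_def dest: T.in_arcsD1 T.in_arcsD2)
  then show ?thesis
    using connected_induce_iff[OF assms subset_refl] by simp
qed

text \<open>A walk from \<open>c'\<close> to \<open>p\<close> off \<open>c\<close> shortens to a
  path with distinct vertices; the arcs \<open>(p, c)\<close>, \<open>(c, c')\<close> close it to a
  cycle, of length at least 3 because \<open>p \<noteq> c'\<close> makes the path non-empty.\<close>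

lemma undirected_tree_separates_neighbours:
  assumes "undirected_tree T"
    and "(p, c) \<in> parcs T" "(c, c') \<in> parcs T" "p \<noteq> c'"
  shows "(c', p) \<notin> (Restr (parcs T) (- {c}))\<^sup>*"
proof
  assume reach: "(c', p) \<in> (Restr (parcs T) (- {c}))\<^sup>*"
  interpret T: pair_graph T using assms by (simp add: undirected_tree_def)
  \<comment> \<open>\<open>H\<close> is \<open>T\<close> with \<open>c\<close> deleted, turned into
    a digraph so that reachability yields a path in it.\<close>
  define H where "H = \<lparr>pverts = pverts T - {c}, parcs = Restr (parcs T) (- {c})\<rparr>"
  interpret H: pair_wf_digraph H
    by unfold_locales (auto simp: H_def dest: T.in_arcsD1 T.in_arcsD2)
  have H: "pverts H = pverts T - {c}" "parcs H = Restr (parcs T) (- {c})"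
    by (simp_all add: H_def)
  have "c' \<noteq> c" "p \<noteq> c"
    using assms T.no_loops by force+
  then have "c' \<in> pverts H" "p \<in> pverts H" "(c', p) \<in> (parcs H)\<^sup>*"
    using reach assms T.in_arcsD1 T.in_arcsD2 by (auto simp: H_def)
  then have "c' \<rightarrow>\<^sup>*\<^bsub>H\<^esub> p"
    by (simp add: H.reachable_conv)
  then obtain q where "H.apath c' q p"
    by (auto simp: H.reachable_apath)
  then have q: "H.awalk c' q p" "distinct (pawalk_verts c' q)"
    by (auto simp: H.apath_def)
  have "set (pawalk_verts c' q) \<subseteq> pverts H"
    using q(1) by (auto elim: H.awalkE)
  then have "c \<notin> set (pawalk_verts c' q)"
    by (auto simp: H_def)
  moreover have "T.awalk c' q p"
    using q(1) by (auto simp: H.awalk_def T.awalk_def H)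
  moreover have "q \<noteq> []"
    using q(1) assms by (auto simp: H.awalk_Nil_iff)
  ultimately have "T.cycle ((p, c) # (c, c') # q)" "length ((p, c) # (c, c') # q) \<ge> 3"
    using assms q(2) T.in_arcsD1
    by (auto simp: T.cycle_def T.awalk_Cons_iff Suc_le_eq intro!: exI[of _ p])
  then show False
    using assms(1) by (auto simp: undirected_tree_def)
qed

text \<open>Take a vertex of largest rank on the cycle together with its two cycle neighbours, which
  differ because the cycle has length at least 3. This serves to show that graphs given by parent
  pointers are acyclic.\<close>

lemma cycle_max_rank:
  fixes rank :: "'a \<Rightarrow> nat"
  assumes "pair_graph T" and "pre_digraph.cycle (with_proj T) p" and "length p \<ge> 3"
  obtains a m b where "(a, m) \<in> parcs T" "(m, b) \<in> parcs T" "a \<noteq> b"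
    "rank a \<le> rank m" "rank b \<le> rank m"
proof -
  interpret T: pair_graph T by fact
  obtain u where u: "T.awalk u p u" "distinct (tl (pawalk_verts u p))"
    using assms(2) by (auto simp: T.cycle_def)
  define n where "n = length p"
  \<comment> \<open>The vertices of the cycle, indexed cyclically by the tails of its arcs.\<close>
  define t where "t i = fst (p ! (i mod n))" for i
  have n: "n \<ge> 3" and "p \<noteq> []"
    using assms(3) by (auto simp: n_def)
  have heads: "pawalk_verts u p = u # map snd p"
    using T.awalk_verts_conv'[of u p u] u(1) \<open>p \<noteq> []\<close> by (cases p) (auto simp: T.awalk_def)
  have "pawalk_verts u p = map fst p @ [snd (last p)]"
    using T.awalk_verts_conv[of u p] \<open>p \<noteq> []\<close> by simp
  moreover have "last (pawalk_verts u p) = u"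
    using u(1) by (rule T.awalkE)
  ultimately have tails: "pawalk_verts u p = map fst p @ [u]"
    by simp
  \<comment> \<open>The vertex sequence read in two ways, by heads after \<open>u\<close> and by
    tails before \<open>u\<close>: the head of each arc is the tail of the next one.\<close>
  have shift: "u # map snd p = map fst p @ [u]"
    using heads tails by simp
  have less: "i mod n < n" for i
    using n by simp
  have head: "snd (p ! (i mod n)) = t (Suc i)" for i
  proof -
    have "snd (p ! (i mod n)) = (u # map snd p) ! Suc (i mod n)"
      using less[of i] by (simp add: n_def)
    also have "\<dots> = (map fst p @ [u]) ! Suc (i mod n)"
      by (simp only: shift)
    also have "\<dots> = t (Suc i)"
    proof (cases "Suc (i mod n) = n")
      case True
      then have "t (Suc i) = fst (p ! 0)"
        by (simp add: t_def mod_Suc)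
      moreover have "u = fst (p ! 0)"
        using shift \<open>p \<noteq> []\<close> by (cases p) auto
      ultimately show ?thesis
        using True by (simp add: nth_append n_def)
    next
      case False
      then show ?thesis
        using less[of i] by (auto simp: t_def nth_append n_def mod_Suc)
    qed
    finally show ?thesis .
  qed
  have arc: "(t i, t (Suc i)) \<in> parcs T" for i
  proof -
    have "p ! (i mod n) \<in> parcs T"
      using u(1) less[of i] by (auto simp: T.awalk_def n_def dest!: subsetD intro!: nth_mem)
    then show ?thesis
      using head[of i] by (metis prod.collapse t_def)
  qed
  have "map snd p = tl (map fst p) @ [u]"
    using shift \<open>p \<noteq> []\<close> by (cases p) auto
  moreover have "u = hd (map fst p)"
    using shift \<open>p \<noteq> []\<close> by (cases p) auto
  ultimately have "distinct (map fst p)"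
    using u(2) heads \<open>p \<noteq> []\<close> by (cases p) auto
  then have inj: "t i = t j \<Longrightarrow> i mod n = j mod n" for i j
    using less[of i] less[of j] nth_eq_iff_index_eq[of "map fst p" "i mod n" "j mod n"] by (simp add: t_def n_def)
  obtain i where i: "i < n" "\<And>j. j < n \<Longrightarrow> rank (t j) \<le> rank (t i)"
    using obtains_MAX[of "{..<n}" "\<lambda>i. rank (t i)"] n
    by (metis Max_ge finite_imageI finite_lessThan image_eqI lessThan_empty_iff lessThan_iff not_numeral_le_zero)
  have max: "rank (t j) \<le> rank (t i)" for j
    using i(2)[OF less[of j]] by (simp add: t_def)
  have period: "t (i + n) = t i" for i
    by (simp add: t_def)
  \<comment> \<open>The predecessor of position \<open>i\<close> is written
    \<open>i + (n - 1)\<close>, which avoids truncated subtraction at \<open>i = 0\<close>.\<close>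
  have "Suc (i + (n - 1)) = i + n"
    using n by simp
  then have "(t (i + (n - 1)), t i) \<in> parcs T"
    using arc[of "i + (n - 1)"] by (simp add: period del: add_Suc)
  moreover have "t (i + (n - 1)) \<noteq> t (Suc i)"
  proof
    assume "t (i + (n - 1)) = t (Suc i)"
    then have "(i + (n - 1)) mod n = Suc i mod n"
      by (rule inj)
    \<comment> \<open>The difference is \<open>n - 2\<close>, which is positive and below
      \<open>n\<close>.\<close>
    then have "n dvd (i + (n - 1)) - Suc i"
      using n by (intro mod_eq_dvd_iff_nat[THEN iffD1]) auto
    then show False
      using n by (auto dest: dvd_imp_le)
  qed
  ultimately show thesis
    using that arc max by blast
qed

text \<open>Ranks drop along parent pointers, so every node of \<open>U\<close> climbs inside
  \<open>U\<close> to \<open>t\<close>. On a cycle, a node of largest rank could only have its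
  parent as either neighbour, contradicting that they differ.\<close>

lemma
  fixes N :: "'b set" and par :: "'b \<Rightarrow> 'b" and rank :: "'b \<Rightarrow> nat"
  assumes fin: "finite N" and root: "r \<in> N"
    and par: "\<And>x. x \<in> N \<Longrightarrow> x \<noteq> r \<Longrightarrow> par x \<in> N \<and> rank (par x) < rank x"
  defines "T \<equiv> \<lparr>pverts = N, parcs = (\<Union>x\<in>N - {r}. {(x, par x), (par x, x)})\<rparr>"
  shows parent_connected: "\<And>U t. U \<subseteq> N \<Longrightarrow> t \<in> U \<Longrightarrow>
      (\<And>x. x \<in> U \<Longrightarrow> x \<noteq> t \<Longrightarrow> x \<noteq> r \<and> par x \<in> U) \<Longrightarrow>
      Digraph_Component.connected (with_proj T \<restriction> U)"
    and parent_tree: "undirected_tree T"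
proof -
  have "par x \<noteq> x" if "x \<in> N" "x \<noteq> r" for x
    using par[OF that] by auto
  then have pg: "pair_graph T"
    using fin par by unfold_locales (force simp: T_def symmetric_def sym_def)+
  then interpret T: pair_graph T .
  show con: "Digraph_Component.connected (with_proj T \<restriction> U)"
    if U: "U \<subseteq> N" "t \<in> U" and top: "\<And>x. x \<in> U \<Longrightarrow> x \<noteq> t \<Longrightarrow> x \<noteq> r \<and> par x \<in> U" for U t
  proof -
    let ?R = "Restr (parcs T) U"
    have "sym ?R"
      using T.arcs_symmetric by (auto simp: sym_def)
    then have symR: "sym (?R\<^sup>*)"
      by (rule sym_rtrancl)
    have to_top: "(x, t) \<in> ?R\<^sup>*" if "x \<in> U" for x
      using that
    proof (induction "rank x" arbitrary: x rule: less_induct)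
      case less
      show ?case
      proof (cases "x = t")
        case False
        then have x: "x \<in> N" "x \<noteq> r" "par x \<in> U"
          using less.prems U top by auto
        then have "(x, par x) \<in> ?R"
          using less.prems by (auto simp: T_def)
        moreover have "(par x, t) \<in> ?R\<^sup>*"
          using less.hyps par x by blast
        ultimately show ?thesis
          by (rule converse_rtrancl_into_rtrancl)
      qed simp
    qed
    then have "(u, v) \<in> ?R\<^sup>*" if "u \<in> U" "v \<in> U" for u v
      using that symD[OF symR] rtrancl_trans by metis
    then show ?thesis
      using U connected_induce_iff[OF pg, of U] by (auto simp: T_def)
  qed
  have "with_proj T \<restriction> N = with_proj T"
    using par root by (auto simp: with_proj_def induce_subgraph_def T_def)
  then have "Digraph_Component.connected (with_proj T)"
    using con[of N r] root par by auto
  moreover have False if cyc: "pre_digraph.cycle (with_proj T) p" "length p \<ge> 3" for p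
  proof -
    obtain a m b where *: "(a, m) \<in> parcs T" "(m, b) \<in> parcs T" "a \<noteq> b"
      "rank a \<le> rank m" "rank b \<le> rank m"
      using cycle_max_rank[OF pg cyc, of rank] .
    then have "a = par m" "b = par m"
      using par by (force simp: T_def)+
    then show False
      using * by simp
  qed
  ultimately show "undirected_tree T"
    using pg by (auto simp: undirected_tree_def)
qed

subsection \<open>Balanced separators\<close>

text \<open>Cut the walk at its last visit to \<open>c\<close>; \<open>c'\<close> is the vertex
  right after it.\<close>

lemma rtrancl_first_step_avoiding:
  assumes "(c, x) \<in> (Restr E A)\<^sup>*" and "x \<noteq> c"
  obtains c' where "c' \<in> A" "(c, c') \<in> E" "(c', x) \<in> (Restr E (- {c}))\<^sup>*"
proof -
  have "x = c \<or> (\<exists>c'\<in>A. (c, c') \<in> E \<and> (c', x) \<in> (Restr E (- {c}))\<^sup>*)"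
    using assms(1)
  proof (induction rule: rtrancl_induct)
    case (step y z)
    show ?case
    proof (cases "y = c \<or> z = c")
      case True
      then show ?thesis using step.hyps by auto
    next
      case False
      then obtain c' where "c' \<in> A" "(c, c') \<in> E" "(c', y) \<in> (Restr E (- {c}))\<^sup>*"
        using step.IH by auto
      moreover have "(y, z) \<in> Restr E (- {c})"
        using False step.hyps by auto
      ultimately show ?thesis
        by (meson rtrancl.rtrancl_into_rtrancl)
    qed
  qed simp
  then show thesis
    using assms(2) that by auto
qed

text \<open>A walk from \<open>c'\<close> off \<open>c\<close> never meets \<open>p\<close>, by the
  separation of neighbours, so prefixing \<open>c\<close> keeps it off \<open>p\<close>. The
  inclusion is strict because \<open>c\<close> is lost. Hence moving the cut away from
  \<open>p\<close> shrinks the branch.\<close>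

lemma tree_branch_psubset:
  assumes "undirected_tree T"
    and "(p, c) \<in> parcs T" "(c, c') \<in> parcs T" "c' \<noteq> p"
  shows "(Restr (parcs T) (- {c}))\<^sup>* `` {c'} \<subset> (Restr (parcs T) (- {p}))\<^sup>* `` {c}"
proof
  interpret T: pair_graph T using assms by (simp add: undirected_tree_def)
  have "(c, z) \<in> (Restr (parcs T) (- {p}))\<^sup>*" if "(c', z) \<in> (Restr (parcs T) (- {c}))\<^sup>*" for z
    using that
  proof (induction rule: rtrancl_induct)
    case base
    show ?case
      using assms T.no_loops by force
  next
    case (step y z)
    have "(c', z) \<in> (Restr (parcs T) (- {c}))\<^sup>*"
      using step.hyps by (rule rtrancl_into_rtrancl)
    then have "y \<noteq> p" "z \<noteq> p"
      using undirected_tree_separates_neighbours[of T p c c'] assms step.hyps(1) by auto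
    then show ?case
      using step by (auto intro: rtrancl_into_rtrancl)
  qed
  then show "(Restr (parcs T) (- {c}))\<^sup>* `` {c'} \<subseteq> (Restr (parcs T) (- {p}))\<^sup>* `` {c}"
    by auto
  have "c' \<noteq> c"
    using assms T.no_loops by force
  then have "(c', c) \<notin> (Restr (parcs T) (- {c}))\<^sup>*"
    by (auto elim: rtranclE)
  then show "(Restr (parcs T) (- {c}))\<^sup>* `` {c'} \<noteq> (Restr (parcs T) (- {p}))\<^sup>* `` {c}"
    by auto
qed

text \<open>
  The node \<open>c\<close> comes from a tree edge \<open>(p, c)\<close> for which the component of \<open>T - p\<close> containing \<open>c\<close> is
  smallest among those whose bags meet more than \<open>t\<close> vertices of \<open>S\<close>.  The colour of a vertex
  outside \<open>B c\<close> is the component of \<open>T - c\<close> in which its bags lie, and \<open>a\<^sub>0\<close> is the one containing \<open>p\<close>.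
\<close>

lemma tree_decomposition_separator:
  fixes T :: "'b pair_pre_digraph" and B :: "'b \<Rightarrow> 'a set" and t :: nat
  assumes G: "pair_graph G" and dec: "tree_decomposition G T B" and S: "S \<subseteq> pverts G"
  obtains c and col :: "'a \<Rightarrow> 'b set" and a\<^sub>0 where "c \<in> pverts T"
    "\<forall>u w. (u, w) \<in> parcs G \<longrightarrow> u \<notin> B c \<longrightarrow> w \<notin> B c \<longrightarrow> col u = col w"
    "\<forall>a. a \<noteq> a\<^sub>0 \<longrightarrow> card {v \<in> S - B c. col v = a} \<le> t"
    "card {v \<in> S - B c. col v = a\<^sub>0} \<le> max t (card S - Suc t)"
proof -
  interpret G: pair_graph G by fact
  have tree: "undirected_tree T"
    using dec by (simp add: tree_decomposition_def)
  then interpret T: pair_graph T by (simp add: undirected_tree_def)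
  have finS: "finite S"
    using S G.pair_finite_verts finite_subset by blast
  define R where "R c = (Restr (parcs T) (- {c}))\<^sup>*" for c
  define nodes where "nodes v = {x \<in> pverts T. v \<in> B x}" for v
  define col where "col c v = R c `` nodes v" for c v
  \<comment> \<open>\<open>D p c\<close> is the branch at \<open>p\<close> through \<open>c\<close>,
    and \<open>W p c\<close> the part of \<open>S\<close> with a bag in that branch;
    \<open>t\<close> is the threshold above which a branch counts as heavy.\<close>
  define D where "D p c = R p `` {c}" for p c
  define W where "W p c = {v \<in> S. nodes v \<inter> D p c \<noteq> {}}" for p c
  have finW: "finite (W p c)" for p c
    using finS by (simp add: W_def)
  have refl: "(x, x) \<in> R c" for x c
    by (simp add: R_def)
  have trans: "(x, z) \<in> R c" if "(x, y) \<in> R c" "(y, z) \<in> R c" for x y z c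
    using that unfolding R_def by (rule rtrancl_trans)
  have sym: "(y, x) \<in> R c" if "(x, y) \<in> R c" for x y c
  proof -
    have "sym (Restr (parcs T) (- {c}))"
      using T.arcs_symmetric by (auto simp: sym_def)
    then show ?thesis
      using that unfolding R_def by (meson sym_rtrancl symD)
  qed
  have class_eq: "R c `` {x} = R c `` {y}" if "(x, y) \<in> R c" for x y c
    using trans[OF that] trans[OF sym[OF that]] by blast
  have con_nodes: "nodes v \<noteq> {}" "\<And>x y. x \<in> nodes v \<Longrightarrow> y \<in> nodes v \<Longrightarrow>
      (x, y) \<in> (Restr (parcs T) (nodes v))\<^sup>*" if "v \<in> pverts G" for v
    using dec that connected_induce_iff[OF T.pair_graph, of "nodes v"]
    by (auto simp: tree_decomposition_def nodes_def)
  have col_eq: "col c v = R c `` {x}" if "v \<in> pverts G" "v \<notin> B c" "x \<in> nodes v" for c v x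
  proof -
    \<comment> \<open>The subtree of a vertex outside \<open>B c\<close> avoids \<open>c\<close>, so
      it stays within a single component of \<open>T - c\<close>.\<close>
    have "Restr (parcs T) (nodes v) \<subseteq> Restr (parcs T) (- {c})"
      using that by (auto simp: nodes_def)
    then have "(x, y) \<in> R c" if "y \<in> nodes v" for y
      using con_nodes(2)[OF \<open>v \<in> pverts G\<close> \<open>x \<in> nodes v\<close> that] rtrancl_mono unfolding R_def by blast
    then show ?thesis
      using that(3) trans unfolding col_def by blast
  qed
  have col_edge: "col c u = col c w"
    if "(u, w) \<in> parcs G" "u \<notin> B c" "w \<notin> B c" for c u w
  proof -
    have "\<exists>x\<in>pverts T. u \<in> B x \<and> w \<in> B x"
      using dec that(1) unfolding tree_decomposition_def by fast
    then obtain x where "x \<in> nodes u" "x \<in> nodes w"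
      by (auto simp: nodes_def)
    then have "col c u = R c `` {x}" "col c w = R c `` {x}"
      using that col_eq G.in_arcsD1[OF that(1)] G.in_arcsD2[OF that(1)] by simp_all
    then show ?thesis
      by simp
  qed
  have branch: "\<exists>c'. (c, c') \<in> parcs T \<and> col c v = D c c'"
    if c: "c \<in> pverts T" and v: "v \<in> pverts G" "v \<notin> B c" for c v
  proof -
    obtain x where x: "x \<in> nodes v"
      using con_nodes(1) v by blast
    then have "x \<noteq> c" "x \<in> pverts T"
      using v by (auto simp: nodes_def)
    moreover have "(c, x) \<in> (Restr (parcs T) UNIV)\<^sup>*"
      using tree c \<open>x \<in> pverts T\<close> connected_iff[OF T.pair_graph] by (simp add: undirected_tree_def)
    ultimately obtain c' where c': "(c, c') \<in> parcs T" "(c', x) \<in> R c"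
      unfolding R_def using rtrancl_first_step_avoiding[of c x] by metis
    have "col c v = R c `` {x}"
      using col_eq v x by blast
    also have "\<dots> = D c c'"
      using class_eq[OF c'(2)] by (simp add: D_def)
    finally show ?thesis
      using c'(1) by blast
  qed
  have class_W: "{v \<in> S - B c. col c v = D c c'} \<subseteq> W c c'" for c c'
  proof -
    have "nodes v \<subseteq> col c v" for v
      using refl by (auto simp: col_def)
    then show ?thesis
      using con_nodes(1) S by (auto simp: W_def) blast
  qed
  have class_le: "card {v \<in> S - B c. col c v = a} \<le> t"
    if c: "c \<in> pverts T"
      and light: "\<And>c'. (c, c') \<in> parcs T \<Longrightarrow> a = D c c' \<Longrightarrow> card (W c c') \<le> t" for c a
  proof (cases "{v \<in> S - B c. col c v = a} = {}")
    case False
    then obtain c' where c': "(c, c') \<in> parcs T" "a = D c c'"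
      using branch[OF c] S by blast
    then have "card {v \<in> S - B c. col c v = a} \<le> card (W c c')"
      using class_W by (intro card_mono finW) auto
    also have "\<dots> \<le> t"
      using light c' by blast
    finally show ?thesis .
  qed (simp only: card.empty)
  show thesis
  proof (cases "\<exists>(p, c)\<in>parcs T. card (W p c) > t")
    case False
    \<comment> \<open>Without a heavy branch, as in a one-node tree, any node separates and the
      exceptional colour is arbitrary.\<close>
    obtain c where "c \<in> pverts T"
      using tree connected_iff[OF T.pair_graph] by (auto simp: undirected_tree_def)
    moreover from this have "card {v \<in> S - B c. col c v = a} \<le> t" for a
      using False by (intro class_le) force+
    ultimately show thesis
      using that[of c "col c"] col_edge by (metis max.coboundedI1)
  next
    case True
    then have "\<exists>e. e \<in> parcs T \<and> card (W (fst e) (snd e)) > t"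
      by force
    then obtain e where "e \<in> parcs T" "card (W (fst e) (snd e)) > t"
      and min: "\<And>e'. e' \<in> parcs T \<Longrightarrow> card (W (fst e') (snd e')) > t \<Longrightarrow>
        card (D (fst e) (snd e)) \<le> card (D (fst e') (snd e'))"
      using ex_has_least_nat[of "\<lambda>e. e \<in> parcs T \<and> card (W (fst e) (snd e)) > t" _
        "\<lambda>e. card (D (fst e) (snd e))"] by blast
    then obtain p c where pc: "(p, c) \<in> parcs T" "card (W p c) > t" "e = (p, c)"
      by (cases e) auto
    have finD: "finite (D p c)"
    proof (rule finite_subset)
      show "D p c \<subseteq> insert c (snd ` parcs T)"
      proof
        fix z assume "z \<in> D p c"
        then have "(c, z) \<in> (Restr (parcs T) (- {p}))\<^sup>*"
          by (simp add: D_def R_def)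
        then show "z \<in> insert c (snd ` parcs T)"
          by cases (auto simp: image_iff intro!: bexI)
      qed
    qed (simp add: T.pair_finite_arcs)
    \<comment> \<open>Branches at \<open>c\<close> not leading back to \<open>p\<close> are strictly
      smaller than \<open>D p c\<close>, hence light by minimality.\<close>
    have "card {v \<in> S - B c. col c v = a} \<le> t" if "a \<noteq> D c p" for a
    proof (rule class_le)
      show "c \<in> pverts T"
        using pc T.in_arcsD2 by blast
      fix c' assume c': "(c, c') \<in> parcs T" "a = D c c'"
      then have "D c c' \<subset> D p c"
        using that tree_branch_psubset[OF tree pc(1)] unfolding D_def R_def by blast
      then have "card (D c c') < card (D p c)"
        using finD psubset_card_mono by blast
      then show "card (W c c') \<le> t"
        using min[of "(c, c')"] c'(1) pc(3) by force
    qed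
    moreover have "card {v \<in> S - B c. col c v = D c p} \<le> card S - Suc t"
    proof -
      \<comment> \<open>Such a vertex has all its bags on the side of \<open>p\<close>. A bag in
        \<open>D p c\<close> would join \<open>p\<close> to another neighbour of \<open>c\<close>
        without passing \<open>c\<close>. So this class misses the at least \<open>t + 1\<close>
        vertices of \<open>W p c\<close>.\<close>
      have "v \<notin> W p c" if v: "v \<in> S - B c" "col c v = D c p" for v
      proof
        assume "v \<in> W p c"
        then obtain x where x: "x \<in> nodes v" "(c, x) \<in> R p"
          by (auto simp: W_def D_def)
        moreover have "x \<noteq> c"
          using x v by (auto simp: nodes_def)
        ultimately obtain c' where c': "c' \<in> - {p}" "(c, c') \<in> parcs T" "(c', x) \<in> R c"
          unfolding R_def using rtrancl_first_step_avoiding[of c x] by metis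
        have "x \<in> col c v"
          using x refl by (auto simp: col_def)
        then have "(p, x) \<in> R c"
          using v by (simp add: D_def)
        then have "(c', p) \<in> R c"
          using trans[OF c'(3) sym] by blast
        then show False
          using undirected_tree_separates_neighbours[OF tree pc(1) c'(2)] c'(1) unfolding R_def by blast
      qed
      then have "{v \<in> S - B c. col c v = D c p} \<subseteq> S - W p c"
        by blast
      then have "card {v \<in> S - B c. col c v = D c p} \<le> card (S - W p c)"
        using finS by (intro card_mono) auto
      also have "\<dots> = card S - card (W p c)"
        using finW by (intro card_Diff_subset) (auto simp: W_def)
      finally show ?thesis
        using pc(2) by simp
    qed
    ultimately show thesis
      using that[of c "col c" "D c p"] col_edge pc(1) T.in_arcsD2 by (simp add: max.coboundedI2)
  qed
qed

text \<open>The colour classes off \<open>X\<close> are the parts, possibly unions of several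
  components. No tree is mentioned, so the property passes to subgraphs without restricting a
  decomposition. The factor 3 avoids rounding.\<close>

definition balanced_separators :: "nat \<Rightarrow> 'a set \<Rightarrow> 'a rel \<Rightarrow> bool" where
  "balanced_separators m V E \<longleftrightarrow> (\<forall>S. S \<subseteq> V \<longrightarrow> (\<exists>X (col :: 'a \<Rightarrow> nat). X \<subseteq> V \<and> card X \<le> m \<and>
     (\<forall>u w. (u, w) \<in> E \<longrightarrow> u \<notin> X \<longrightarrow> w \<notin> X \<longrightarrow> col u = col w) \<and>
     (\<forall>i. 3 * card {v \<in> S - X. col v = i} \<le> card S)))"

lemma balanced_separatorsE:
  assumes "balanced_separators m V E" and "S \<subseteq> V"
  obtains X and col :: "'a \<Rightarrow> nat" where "X \<subseteq> V" "card X \<le> m"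
    "\<forall>u w. (u, w) \<in> E \<longrightarrow> u \<notin> X \<longrightarrow> w \<notin> X \<longrightarrow> col u = col w"
    "\<forall>i. 3 * card {v \<in> S - X. col v = i} \<le> card S"
proof -
  have "\<exists>X (col :: 'a \<Rightarrow> nat). X \<subseteq> V \<and> card X \<le> m \<and>
     (\<forall>u w. (u, w) \<in> E \<longrightarrow> u \<notin> X \<longrightarrow> w \<notin> X \<longrightarrow> col u = col w) \<and>
     (\<forall>i. 3 * card {v \<in> S - X. col v = i} \<le> card S)" (is "\<exists>X col. ?P X col")
    using assms by (simp add: balanced_separators_def)
  then obtain X and col :: "'a \<Rightarrow> nat" where "?P X col"
    by (elim exE)
  then show thesis
    using that[of X col] by simp
qed

text \<open>Intersect the separator with \<open>V'\<close>. Since \<open>S\<close> and the ends of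
  \<open>E'\<close> lie in \<open>V'\<close>, this changes neither \<open>S - X\<close> nor which
  edges avoid \<open>X\<close>.\<close>

lemma balanced_separators_mono:
  assumes "balanced_separators m V E" "finite V" "V' \<subseteq> V" "E' \<subseteq> E" "E' \<subseteq> V' \<times> V'"
  shows "balanced_separators m V' E'"
  unfolding balanced_separators_def
proof (intro allI impI)
  fix S assume S: "S \<subseteq> V'"
  then have "S \<subseteq> V"
    using assms(3) by blast
  with assms(1) obtain X and col :: "'a \<Rightarrow> nat" where X: "X \<subseteq> V" "card X \<le> m"
    and col: "\<forall>u w. (u, w) \<in> E \<longrightarrow> u \<notin> X \<longrightarrow> w \<notin> X \<longrightarrow> col u = col w"
    and bal: "\<forall>i. 3 * card {v \<in> S - X. col v = i} \<le> card S"
    by (rule balanced_separatorsE)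
  have "finite X"
    using X assms(2) finite_subset by blast
  then have "card (X \<inter> V') \<le> m"
    using X card_mono[of X "X \<inter> V'"] by auto
  moreover have "S - X \<inter> V' = S - X"
    using S by blast
  ultimately show "\<exists>X (col :: 'a \<Rightarrow> nat). X \<subseteq> V' \<and> card X \<le> m \<and>
     (\<forall>u w. (u, w) \<in> E' \<longrightarrow> u \<notin> X \<longrightarrow> w \<notin> X \<longrightarrow> col u = col w) \<and>
     (\<forall>i. 3 * card {v \<in> S - X. col v = i} \<le> card S)"
    using col bal assms(4,5) by (intro exI[of _ "X \<inter> V'"] exI[of _ col]) auto
qed

text \<open>The first bag leaves at most one class larger than \<open>t\<close>; a second bag,
  chosen for that class alone, breaks it up. Two bags make the factor 2.\<close>

lemma tree_decomposition_balanced_separators: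
  fixes T :: "'b pair_pre_digraph" and B :: "'b \<Rightarrow> 'a set"
  assumes G: "pair_graph G" and dec: "tree_decomposition G T B"
    and size: "\<And>x. x \<in> pverts T \<Longrightarrow> card (B x) \<le> b"
  shows "balanced_separators (2 * b) (pverts G) (parcs G)"
  unfolding balanced_separators_def
proof (intro allI impI)
  interpret G: pair_graph G by fact
  fix S assume S: "S \<subseteq> pverts G"
  then have finS: "finite S"
    using G.pair_finite_verts finite_subset by blast
  define t where "t = card S div 3"
  obtain c\<^sub>1 and col\<^sub>1 :: "'a \<Rightarrow> 'b set" and a\<^sub>1 where c1: "c\<^sub>1 \<in> pverts T"
    and edge1: "\<forall>u w. (u, w) \<in> parcs G \<longrightarrow> u \<notin> B c\<^sub>1 \<longrightarrow> w \<notin> B c\<^sub>1 \<longrightarrow> col\<^sub>1 u = col\<^sub>1 w"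
    and light1: "\<forall>a. a \<noteq> a\<^sub>1 \<longrightarrow> card {v \<in> S - B c\<^sub>1. col\<^sub>1 v = a} \<le> t"
    and heavy1: "card {v \<in> S - B c\<^sub>1. col\<^sub>1 v = a\<^sub>1} \<le> max t (card S - Suc t)"
    by (rule tree_decomposition_separator[OF G dec S, of t])
  define S' where "S' = {v \<in> S - B c\<^sub>1. col\<^sub>1 v = a\<^sub>1}"
  have S': "S' \<subseteq> pverts G"
    using S by (auto simp: S'_def)
  obtain c\<^sub>2 and col\<^sub>2 :: "'a \<Rightarrow> 'b set" and a\<^sub>2 where c2: "c\<^sub>2 \<in> pverts T"
    and edge2: "\<forall>u w. (u, w) \<in> parcs G \<longrightarrow> u \<notin> B c\<^sub>2 \<longrightarrow> w \<notin> B c\<^sub>2 \<longrightarrow> col\<^sub>2 u = col\<^sub>2 w"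
    and light2: "\<forall>a. a \<noteq> a\<^sub>2 \<longrightarrow> card {v \<in> S' - B c\<^sub>2. col\<^sub>2 v = a} \<le> t"
    and heavy2: "card {v \<in> S' - B c\<^sub>2. col\<^sub>2 v = a\<^sub>2} \<le> max t (card S' - Suc t)"
    by (rule tree_decomposition_separator[OF G dec S', of t])
  define X where "X = B c\<^sub>1 \<union> B c\<^sub>2"
  \<comment> \<open>Pairs of colours become natural numbers; injectivity on the finitely many pairs
    that occur is enough.\<close>
  obtain f :: "_ \<Rightarrow> nat" where f: "inj_on f ((\<lambda>v. (col\<^sub>1 v, col\<^sub>2 v)) ` pverts G)"
    using finite_imp_inj_to_nat_seg[of "(\<lambda>v. (col\<^sub>1 v, col\<^sub>2 v)) ` pverts G"] G.pair_finite_verts by blast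
  define col where "col v = f (col\<^sub>1 v, col\<^sub>2 v)" for v
  have "X \<subseteq> pverts G"
    using dec c1 c2 by (auto simp: X_def tree_decomposition_def)
  moreover have "card X \<le> 2 * b"
    using card_Un_le[of "B c\<^sub>1" "B c\<^sub>2"] size[OF c1] size[OF c2] by (simp add: X_def)
  moreover have "col u = col w" if "(u, w) \<in> parcs G" "u \<notin> X" "w \<notin> X" for u w
    using edge1 edge2 that by (simp add: X_def col_def)
  moreover have "3 * card {v \<in> S - X. col v = i} \<le> card S" for i
  proof (cases "{v \<in> S - X. col v = i} = {}")
    case False
    then obtain v\<^sub>0 where v0: "v\<^sub>0 \<in> S" "col v\<^sub>0 = i"
      by blast
    have eq: "col\<^sub>1 v = col\<^sub>1 v\<^sub>0 \<and> col\<^sub>2 v = col\<^sub>2 v\<^sub>0" if "v \<in> S" "col v = i" for v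
      using inj_onD[OF f, of "(col\<^sub>1 v, col\<^sub>2 v)" "(col\<^sub>1 v\<^sub>0, col\<^sub>2 v\<^sub>0)"] that v0 S
      by (auto simp: col_def)
    have "card {v \<in> S - X. col v = i} \<le> t"
    proof (cases "col\<^sub>1 v\<^sub>0 = a\<^sub>1")
      case True
      have "card {v \<in> S - X. col v = i} \<le> card {v \<in> S' - B c\<^sub>2. col\<^sub>2 v = col\<^sub>2 v\<^sub>0}"
        using finS eq True by (intro card_mono) (auto simp: S'_def X_def)
      also have "\<dots> \<le> t"
      proof (cases "col\<^sub>2 v\<^sub>0 = a\<^sub>2")
        case True
        \<comment> \<open>The rounding just works: \<open>card S\<close> is at most
          \<open>3 * t + 2\<close>, so \<open>S'\<close> has at most \<open>2 * t + 1\<close>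
          elements, and removing \<open>t + 1\<close> leaves at most \<open>t\<close>.\<close>
        have "card S' \<le> max t (card S - Suc t)" "card S \<le> 3 * t + 2"
          using heavy1 by (simp_all add: S'_def t_def)
        then show ?thesis
          using heavy2 True by simp
      qed (use light2 in blast)
      finally show ?thesis .
    next
      case False
      have "card {v \<in> S - X. col v = i} \<le> card {v \<in> S - B c\<^sub>1. col\<^sub>1 v = col\<^sub>1 v\<^sub>0}"
        using finS eq by (intro card_mono) (auto simp: X_def)
      also have "\<dots> \<le> t"
        using light1 False by blast
      finally show ?thesis .
    qed
    then show ?thesis
      by (simp add: t_def)
  qed (metis card.empty mult_0_right zero_le)
  ultimately show "\<exists>X (col :: 'a \<Rightarrow> nat). X \<subseteq> pverts G \<and> card X \<le> 2 * b \<and>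
     (\<forall>u w. (u, w) \<in> parcs G \<longrightarrow> u \<notin> X \<longrightarrow> w \<notin> X \<longrightarrow> col u = col w) \<and>
     (\<forall>i. 3 * card {v \<in> S - X. col v = i} \<le> card S)"
    by (intro exI[of _ X] exI[of _ col]) auto
qed

subsection \<open>Recursive construction\<close>

text \<open>
  A tree is encoded as a prefix-closed set of lists: the root is \<open>[]\<close> and the parent of \<open>x\<close> is
  \<open>butlast x\<close>.  The last conjunct is connectedness of the set of nodes whose bags contain \<open>v\<close>,
  with \<open>t\<close> as the node closest to the root.
\<close>

definition list_decomposition ::
    "'a set \<Rightarrow> 'a rel \<Rightarrow> nat list set \<Rightarrow> (nat list \<Rightarrow> 'a set) \<Rightarrow> bool" where
  "list_decomposition V E N B \<longleftrightarrow> finite N \<and> [] \<in> N \<and>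
     (\<forall>x\<in>N. x \<noteq> [] \<longrightarrow> butlast x \<in> N) \<and>
     (\<forall>x\<in>N. B x \<subseteq> V) \<and>
     (\<forall>u w. (u, w) \<in> E \<longrightarrow> (\<exists>x\<in>N. u \<in> B x \<and> w \<in> B x)) \<and>
     (\<forall>v\<in>V. \<exists>t\<in>N. v \<in> B t \<and> (\<forall>x\<in>N. v \<in> B x \<longrightarrow> x \<noteq> t \<longrightarrow> x \<noteq> [] \<and> v \<in> B (butlast x)))"

section \<open>Gluing decompositions under a new root bag\<close>

definition graft_nodes :: "nat set \<Rightarrow> (nat \<Rightarrow> nat list set) \<Rightarrow> nat list set" where
  "graft_nodes I N = insert [] (\<Union>i\<in>I. (#) i ` N i)"

definition graft_bags :: "'a set \<Rightarrow> (nat \<Rightarrow> nat list \<Rightarrow> 'a set) \<Rightarrow> nat list \<Rightarrow> 'a set" where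
  "graft_bags R B x = (case x of [] \<Rightarrow> R | i # xs \<Rightarrow> B i xs)"

text \<open>A vertex of \<open>R\<close> may occur below several children, but always in their root
  bags, so its occurrences join up at the new root. A vertex outside \<open>R\<close> belongs to one
  child only, whose top node for it is kept.\<close>

lemma list_decomposition_graft:
  assumes I: "finite I"
    and dec: "\<And>i. i \<in> I \<Longrightarrow> list_decomposition (V' i) (E' i) (N i) (B i)"
    and V: "R \<subseteq> V" "\<And>i. i \<in> I \<Longrightarrow> V' i \<subseteq> V" "V \<subseteq> R \<union> (\<Union>i\<in>I. V' i)"
    and root: "\<And>i. i \<in> I \<Longrightarrow> V' i \<inter> R \<subseteq> B i []"
    and disj: "\<And>i j. i \<in> I \<Longrightarrow> j \<in> I \<Longrightarrow> i \<noteq> j \<Longrightarrow> V' i \<inter> V' j \<subseteq> R"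
    and E: "E \<subseteq> R \<times> R \<union> (\<Union>i\<in>I. E' i)"
  shows "list_decomposition V E (graft_nodes I N) (graft_bags R B)"
proof -
  have nodes: "x \<in> graft_nodes I N \<longleftrightarrow> x = [] \<or> (\<exists>i xs. x = i # xs \<and> i \<in> I \<and> xs \<in> N i)" for x
    by (auto simp: graft_nodes_def)
  have bags [simp]: "graft_bags R B [] = R" "graft_bags R B (i # xs) = B i xs" for i xs
    by (simp_all add: graft_bags_def)
  have fin: "finite (N i)" and nil: "[] \<in> N i"
    and but: "\<And>x. x \<in> N i \<Longrightarrow> x \<noteq> [] \<Longrightarrow> butlast x \<in> N i"
    and sub: "\<And>x. x \<in> N i \<Longrightarrow> B i x \<subseteq> V' i"
    and edge: "\<And>u w. (u, w) \<in> E' i \<Longrightarrow> \<exists>x\<in>N i. u \<in> B i x \<and> w \<in> B i x"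
    and top: "\<And>v. v \<in> V' i \<Longrightarrow> \<exists>t\<in>N i. v \<in> B i t \<and>
       (\<forall>x\<in>N i. v \<in> B i x \<longrightarrow> x \<noteq> t \<longrightarrow> x \<noteq> [] \<and> v \<in> B i (butlast x))" if "i \<in> I" for i
    using dec[OF that] unfolding list_decomposition_def by blast+
  show ?thesis
    unfolding list_decomposition_def
  proof (intro conjI allI impI ballI)
    show "finite (graft_nodes I N)"
      using I fin by (simp add: graft_nodes_def)
    show "[] \<in> graft_nodes I N"
      by (simp add: nodes)
    show "butlast x \<in> graft_nodes I N" if x: "x \<in> graft_nodes I N" "x \<noteq> []" for x
    proof -
      obtain i xs where "x = i # xs" "i \<in> I" "xs \<in> N i"
        using x by (auto simp: nodes)
      then show ?thesis
        using but[of i xs] by (cases "xs = []") (auto simp: nodes)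
    qed
    show "graft_bags R B x \<subseteq> V" if "x \<in> graft_nodes I N" for x
    proof (cases x)
      case (Cons i xs)
      then have "i \<in> I" "xs \<in> N i"
        using that by (auto simp: nodes)
      then show ?thesis
        using Cons V(2)[of i] sub[of i xs] by simp
    qed (simp add: V(1))
    show "\<exists>x\<in>graft_nodes I N. u \<in> graft_bags R B x \<and> w \<in> graft_bags R B x"
      if "(u, w) \<in> E" for u w
    proof (cases "u \<in> R \<and> w \<in> R")
      case True
      then show ?thesis
        by (intro bexI[of _ "[]"]) (auto simp: nodes)
    next
      case False
      then obtain i where i: "i \<in> I" "(u, w) \<in> E' i"
        using E \<open>(u, w) \<in> E\<close> by blast
      then obtain x where "x \<in> N i" "u \<in> B i x" "w \<in> B i x"
        using edge by blast
      then show ?thesis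
        using i by (intro bexI[of _ "i # x"]) (auto simp: nodes)
    qed
    show "\<exists>t\<in>graft_nodes I N. v \<in> graft_bags R B t \<and> (\<forall>x\<in>graft_nodes I N.
        v \<in> graft_bags R B x \<longrightarrow> x \<noteq> t \<longrightarrow> x \<noteq> [] \<and> v \<in> graft_bags R B (butlast x))"
      if v: "v \<in> V" for v
    proof (cases "v \<in> R")
      case True
      have "v \<in> graft_bags R B (butlast (i # xs))"
        if i: "i \<in> I" and xs: "xs \<in> N i" "v \<in> B i xs" for i xs
      proof (cases "xs = []")
        case False
        have vi: "v \<in> V' i" "v \<in> B i []"
          using sub[OF i] xs root[OF i] True by auto
        then obtain t where t: "t \<in> N i"
          "\<forall>x\<in>N i. v \<in> B i x \<longrightarrow> x \<noteq> t \<longrightarrow> x \<noteq> [] \<and> v \<in> B i (butlast x)"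
          using top[OF i] by blast
        \<comment> \<open>The root of the child contains \<open>v\<close>, and a node other than
          \<open>t\<close> containing \<open>v\<close> cannot be the root.\<close>
        then have "t = []"
          using vi nil[OF i] by blast
        then show ?thesis
          using t xs False by simp
      qed (use True in simp)
      then show ?thesis
        using True by (intro bexI[of _ "[]"]) (auto simp: nodes simp del: butlast.simps)
    next
      case False
      then obtain i where i: "i \<in> I" "v \<in> V' i"
        using v V(3) by blast
      then obtain t where t: "t \<in> N i" "v \<in> B i t"
          "\<forall>x\<in>N i. v \<in> B i x \<longrightarrow> x \<noteq> t \<longrightarrow> x \<noteq> [] \<and> v \<in> B i (butlast x)"
        using top by blast
      have "x \<noteq> [] \<and> v \<in> graft_bags R B (butlast x)"
        if x: "x \<in> graft_nodes I N" "v \<in> graft_bags R B x" "x \<noteq> i # t" for x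
      proof -
        obtain j xs where j: "x = j # xs" "j \<in> I" "xs \<in> N j"
          using x False by (auto simp: nodes)
        then have "v \<in> V' j"
          using sub x(2) by auto
        then have "j = i"
          using disj[OF j(2) i(1)] i False by blast
        then show ?thesis
          using t(3) x j by auto
      qed
      then show ?thesis
        using t i by (intro bexI[of _ "i # t"]) (auto simp: nodes)
    qed
  qed
qed

lemma graft_occurrences:
  "{x \<in> graft_nodes I N. v \<in> graft_bags R B x} =
    (if v \<in> R then {[]} else {}) \<union> (\<Union>i\<in>I. (#) i ` {x \<in> N i. v \<in> B i x})"
  by (auto simp: graft_nodes_def graft_bags_def)

lemma card_graft_occurrences_le:
  assumes "finite I" "\<And>i. i \<in> I \<Longrightarrow> finite (N i)"
  shows "card {x \<in> graft_nodes I N. v \<in> graft_bags R B x} \<le>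
    (if v \<in> R then 1 else 0) + (\<Sum>i\<in>I. card {x \<in> N i. v \<in> B i x})"
proof -
  have "card {x \<in> graft_nodes I N. v \<in> graft_bags R B x} \<le>
    card (if v \<in> R then {[]::nat list} else {}) + card (\<Union>i\<in>I. (#) i ` {x \<in> N i. v \<in> B i x})"
    unfolding graft_occurrences by (rule card_Un_le)
  also have "card (\<Union>i\<in>I. (#) i ` {x \<in> N i. v \<in> B i x}) \<le>
      (\<Sum>i\<in>I. card ((#) i ` {x \<in> N i. v \<in> B i x}))"
    using assms by (intro card_UN_le) auto
  also have "\<dots> = (\<Sum>i\<in>I. card {x \<in> N i. v \<in> B i x})"
    by (intro sum.cong refl card_image) (simp add: inj_on_def)
  finally show ?thesis
    by auto
qed

section \<open>The induction producing low spread\<close>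

text \<open>The extra 1 for \<open>v \<in> S\<close> is a reserve for the caller: each child then
  holds a vertex of \<open>R\<close> at most as often as that vertex has edges in the child. The
  measure drops through \<open>E\<close> if \<open>S\<close> is non-empty and through
  \<open>V - S\<close> otherwise.\<close>

lemma low_spread_decomposition:
  fixes V S :: "'a set" and E :: "'a rel"
  assumes "finite V" "E \<subseteq> V \<times> V" "sym E" "balanced_separators m V E" "m \<ge> 1"
    and "S \<subseteq> V" "card S \<le> 3 * m" "\<And>v. v \<in> S \<Longrightarrow> E `` {v} \<noteq> {}"
  shows "\<exists>N B. list_decomposition V E N B \<and> S \<subseteq> B [] \<and> (\<forall>x\<in>N. card (B x) \<le> 7 * m) \<and>
    (\<forall>v\<in>V. card {x \<in> N. v \<in> B x} + (if v \<in> S then 1 else 0) \<le> card (E `` {v}) + 1)"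
  using assms
proof (induction "card E + card (V - S)" arbitrary: V E S rule: less_induct)
  case less
  note finV = less.prems(1) and EV = less.prems(2) and symE = less.prems(3)
    and sep = less.prems(4) and m = less.prems(5) and SV = less.prems(6)
    and cardS = less.prems(7) and deg = less.prems(8)
  have finE: "finite E"
    using EV finV finite_subset by blast
  have finS: "finite S"
    using SV finV finite_subset by blast
  \<comment> \<open>\<open>S'\<close> is kept non-empty even for \<open>S = {}\<close>, so that the
    root bag makes progress when there is no edge to remove.\<close>
  have "\<exists>S'. S \<subseteq> S' \<and> S' \<subseteq> V \<and> card S' \<le> 6 * m \<and> (\<forall>v\<in>S. \<exists>w\<in>S'. (v, w) \<in> E) \<and>
    (V \<noteq> {} \<longrightarrow> S' \<noteq> {})"
  proof (cases "S = {}")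
    case True
    show ?thesis
    proof (cases "V = {}")
      case False
      then obtain v where "v \<in> V"
        by blast
      then show ?thesis
        using True m by (intro exI[of _ "{v}"]) auto
    qed (use True in auto)
  next
    case False
    have "\<forall>v\<in>S. \<exists>w. (v, w) \<in> E"
      using deg by blast
    then obtain f where f: "\<forall>v\<in>S. (v, f v) \<in> E"
      by metis
    have "card (S \<union> f ` S) \<le> card S + card (f ` S)"
      by (rule card_Un_le)
    also have "\<dots> \<le> 6 * m"
      using cardS card_image_le[OF finS, of f] by simp
    finally show ?thesis
      using f SV EV False by (intro exI[of _ "S \<union> f ` S"]) blast
  qed
  then obtain S' where S': "S \<subseteq> S'" "S' \<subseteq> V" "card S' \<le> 6 * m"
    and partner: "\<forall>v\<in>S. \<exists>w\<in>S'. (v, w) \<in> E"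
    and nonempty: "V \<noteq> {} \<Longrightarrow> S' \<noteq> {}"
    by meson
  have finS': "finite S'"
    using S'(2) finV finite_subset by blast
  obtain X and col :: "'a \<Rightarrow> nat" where X: "X \<subseteq> V" "card X \<le> m"
    and col: "\<forall>u w. (u, w) \<in> E \<longrightarrow> u \<notin> X \<longrightarrow> w \<notin> X \<longrightarrow> col u = col w"
    and bal: "\<forall>i. 3 * card {v \<in> S' - X. col v = i} \<le> card S'"
    using sep S'(2) by (rule balanced_separatorsE)
  have finX: "finite X"
    using X(1) finV finite_subset by blast
  define R where "R = S' \<union> X"
  define I where "I = col ` V"
  \<comment> \<open>An edge gets the colour of an end outside \<open>X\<close>; colours on
    \<open>X\<close> carry no information. A vertex of \<open>R\<close> enters \<open>V' i\<close>
    only through an edge of \<open>E' i\<close>.\<close>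
  define E' where "E' i = {(u, w) \<in> E. \<not> (u \<in> R \<and> w \<in> R) \<and> (u \<notin> X \<and> col u = i \<or> w \<notin> X \<and> col w = i)}" for i
  define V' where "V' i = {v \<in> V - R. col v = i} \<union> Domain (E' i)" for i
  have RV: "R \<subseteq> V"
    using S' X by (simp add: R_def)
  have E'E: "E' i \<subseteq> E" for i
    by (auto simp: E'_def)
  have E'_col: "col u = i" if "(u, w) \<in> E' i" "u \<notin> X" for u w i
    using that col by (auto simp: E'_def)
  have symE': "sym (E' i)" for i
    using symE by (auto simp: E'_def sym_def)
  have V'V: "V' i \<subseteq> V" for i
    using E'E EV by (auto simp: V'_def)
  have E'V': "E' i \<subseteq> V' i \<times> V' i" for i
    using symD[OF symE'] by (auto simp: V'_def)
  have V'_col: "col v = i" if "v \<in> V' i" "v \<notin> X" for v i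
    using that E'_col by (auto simp: V'_def)
  have V'_R: "V' i \<inter> R = Domain (E' i) \<inter> R" for i
    by (auto simp: V'_def)
  have child: "\<exists>N B. list_decomposition (V' i) (E' i) N B \<and> V' i \<inter> R \<subseteq> B [] \<and>
      (\<forall>x\<in>N. card (B x) \<le> 7 * m) \<and>
      (\<forall>v\<in>V' i. card {x \<in> N. v \<in> B x} + (if v \<in> V' i \<inter> R then 1 else 0) \<le> card (E' i `` {v}) + 1)"
    if i: "i \<in> I" for i
  proof (rule less.hyps)
    have diff: "V' i - V' i \<inter> R \<subseteq> V - R" "V - R \<subseteq> V - S"
      using V'V S'(1) by (auto simp: R_def)
    have le: "card (E' i) \<le> card E" "card (V' i - V' i \<inter> R) \<le> card (V - S)"
      using diff finV finE E'E by (auto intro!: card_mono)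
    show "card (E' i) + card (V' i - V' i \<inter> R) < card E + card (V - S)"
    proof (cases "S = {}")
      case True
      have "V \<noteq> {}"
        using i by (auto simp: I_def)
      then obtain v where "v \<in> S'"
        using nonempty by blast
      then have "V' i - V' i \<inter> R \<subset> V - S"
        using diff True S' by (auto simp: R_def)
      then have "card (V' i - V' i \<inter> R) < card (V - S)"
        using finV by (intro psubset_card_mono) auto
      then show ?thesis
        using le by simp
    next
      case False
      then obtain v w where "v \<in> S" "w \<in> S'" "(v, w) \<in> E"
        using partner by blast
      then have "(v, w) \<in> E - E' i"
        using S' by (auto simp: E'_def R_def)
      then have "card (E' i) < card E"
        using E'E finE by (intro psubset_card_mono) auto
      then show ?thesis
        using le by simp
    qed
    show "finite (V' i)"
      using V'V finV finite_subset by blast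
    show "balanced_separators m (V' i) (E' i)"
      using sep finV V'V E'E E'V' by (rule balanced_separators_mono)
    \<comment> \<open>All of \<open>X\<close> may recur in one child, but of \<open>S' - X\<close>
      only the class of colour \<open>i\<close>, which is at most a third of
      \<open>6 * m\<close>.\<close>
    have "V' i \<inter> R \<subseteq> X \<union> {v \<in> S' - X. col v = i}"
      using V'_col by (auto simp: R_def)
    then have "card (V' i \<inter> R) \<le> card (X \<union> {v \<in> S' - X. col v = i})"
      using finX finS' by (intro card_mono) auto
    also have "\<dots> \<le> card X + card {v \<in> S' - X. col v = i}"
      by (rule card_Un_le)
    also have "\<dots> \<le> 3 * m"
      using bal[rule_format, of i] X(2) S'(3) by linarith
    finally show "card (V' i \<inter> R) \<le> 3 * m" .
    show "E' i `` {v} \<noteq> {}" if "v \<in> V' i \<inter> R" for v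
      using that V'_R by auto
  qed (use E'V' symE' m in auto)
  define child_dec where "child_dec i N B \<longleftrightarrow> list_decomposition (V' i) (E' i) N B \<and>
      V' i \<inter> R \<subseteq> B [] \<and> (\<forall>x\<in>N. card (B x) \<le> 7 * m) \<and>
      (\<forall>v\<in>V' i. card {x \<in> N. v \<in> B x} + (if v \<in> V' i \<inter> R then 1 else 0) \<le> card (E' i `` {v}) + 1)"
    for i N B
  have "\<forall>i\<in>I. \<exists>N B. child_dec i N B"
    using child by (simp add: child_dec_def)
  then obtain N B where NB: "\<forall>i\<in>I. child_dec i (N i) (B i)"
    by metis
  have dec: "list_decomposition (V' i) (E' i) (N i) (B i)"
    and root: "V' i \<inter> R \<subseteq> B i []"
    and size: "\<And>x. x \<in> N i \<Longrightarrow> card (B i x) \<le> 7 * m"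
    and spread: "\<And>v. v \<in> V' i \<Longrightarrow> card {x \<in> N i. v \<in> B i x} + (if v \<in> V' i \<inter> R then 1 else 0)
      \<le> card (E' i `` {v}) + 1" if "i \<in> I" for i
    using NB that unfolding child_dec_def by blast+
  have finI: "finite I"
    using finV by (simp add: I_def)
  have finN: "finite (N i)" if "i \<in> I" for i
    using dec[OF that] by (simp add: list_decomposition_def)
  have outside: "card {x \<in> N i. v \<in> B i x} = 0" if "i \<in> I" "v \<notin> V' i" for i v
  proof -
    have "{x \<in> N i. v \<in> B i x} = {}"
      using dec[OF that(1)] that(2) by (auto simp: list_decomposition_def)
    then show ?thesis
      by (simp only: card.empty)
  qed
  let ?N = "graft_nodes I N" and ?B = "graft_bags R B"
  have "list_decomposition V E ?N ?B"
  proof (rule list_decomposition_graft[OF finI dec RV V'V])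
    show "V \<subseteq> R \<union> (\<Union>i\<in>I. V' i)"
      by (auto simp: V'_def I_def)
    show "V' i \<inter> V' j \<subseteq> R" if "i \<noteq> j" for i j
      using that V'_col by (auto simp: R_def)
    show "E \<subseteq> R \<times> R \<union> (\<Union>i\<in>I. E' i)"
    proof
      fix e assume "e \<in> E"
      then obtain u w where e: "e = (u, w)" "u \<in> V" "w \<in> V" "(u, w) \<in> E"
        using EV by auto
      then show "e \<in> R \<times> R \<union> (\<Union>i\<in>I. E' i)"
        by (auto simp: E'_def I_def R_def)
    qed
  qed (use root in auto)
  moreover have "S \<subseteq> ?B []"
    using S' by (auto simp: graft_bags_def R_def)
  moreover have "card (?B x) \<le> 7 * m" if "x \<in> ?N" for x
  proof (cases x)
    case Nil
    have "card R \<le> card S' + card X"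
      unfolding R_def by (rule card_Un_le)
    then show ?thesis
      using Nil S'(3) X(2) by (simp add: graft_bags_def)
  next
    case (Cons i xs)
    then show ?thesis
      using that size by (auto simp: graft_nodes_def graft_bags_def)
  qed
  moreover have "card {x \<in> ?N. v \<in> ?B x} + (if v \<in> S then 1 else 0) \<le> card (E `` {v}) + 1"
    if v: "v \<in> V" for v
  proof (cases "v \<in> R")
    case True
    have fin_nbrs: "finite (E `` {v})"
      using finE by (rule finite_Image)
    have "card {x \<in> ?N. v \<in> ?B x} \<le> 1 + (\<Sum>i\<in>I. card {x \<in> N i. v \<in> B i x})"
      using card_graft_occurrences_le[where v = v and R = R and B = B, OF finI finN] True by simp
    also have "(\<Sum>i\<in>I. card {x \<in> N i. v \<in> B i x}) \<le> (\<Sum>i\<in>I. card (E' i `` {v}))"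
    proof (rule sum_mono)
      fix i assume "i \<in> I"
      \<comment> \<open>The reserve of the child cancels the \<open>+ 1\<close> in its bound; a
        child without \<open>v\<close> contributes 0.\<close>
      then show "card {x \<in> N i. v \<in> B i x} \<le> card (E' i `` {v})"
        using spread[of i v] outside[of i v] True by (cases "v \<in> V' i") auto
    qed
    also have "\<dots> = card (\<Union>i\<in>I. E' i `` {v})"
    proof (rule card_UN_disjoint[symmetric])
      show "\<forall>i\<in>I. \<forall>j\<in>I. i \<noteq> j \<longrightarrow> E' i `` {v} \<inter> E' j `` {v} = {}"
      proof (intro ballI impI)
        fix i j :: nat assume "i \<noteq> j"
        have "i = j" if w: "(v, w) \<in> E' i" "(v, w) \<in> E' j" for w
        proof -
          \<comment> \<open>As \<open>v\<close> lies in \<open>R\<close> and the edge is not inside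
            \<open>R\<close>, its other end is outside \<open>X\<close> and fixes the
            colour.\<close>
          have "w \<notin> X"
            using w(1) True by (auto simp: E'_def R_def)
          then show ?thesis
            using E'_col[OF symD[OF symE' w(1)]] E'_col[OF symD[OF symE' w(2)]] by simp
        qed
        then show "E' i `` {v} \<inter> E' j `` {v} = {}"
          using \<open>i \<noteq> j\<close> by blast
      qed
      show "\<forall>i\<in>I. finite (E' i `` {v})"
        using finE E'E by (blast intro: finite_Image finite_subset)
    qed (fact finI)
    finally have "card {x \<in> ?N. v \<in> ?B x} \<le> 1 + card (\<Union>i\<in>I. E' i `` {v})"
      by simp
    moreover have "card (\<Union>i\<in>I. E' i `` {v}) + (if v \<in> S then 1 else 0) \<le> card (E `` {v})"
    proof (cases "v \<in> S")
      case vS: True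
      then obtain w where "w \<in> S'" "(v, w) \<in> E"
        using partner by blast
      \<comment> \<open>The edge from \<open>v\<close> to its partner lies inside \<open>R\<close>,
        hence in no child; it pays for the occurrence in the root bag.\<close>
      then have "(\<Union>i\<in>I. E' i `` {v}) \<subset> E `` {v}"
        using E'E True by (auto simp: E'_def R_def)
      then have "card (\<Union>i\<in>I. E' i `` {v}) < card (E `` {v})"
        by (rule psubset_card_mono[OF fin_nbrs])
      then show ?thesis
        using vS by simp
    next
      case False
      have "card (\<Union>i\<in>I. E' i `` {v}) \<le> card (E `` {v})"
        using E'E by (intro card_mono fin_nbrs) blast
      then show ?thesis
        using False by simp
    qed
    ultimately show ?thesis
      by linarith
  next
    case False
    then have "v \<notin> S"
      using S'(1) by (auto simp: R_def)
    have i: "col v \<in> I" "v \<in> V' (col v)"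
      using v False by (auto simp: I_def V'_def)
    have "v \<notin> X"
      using False by (simp add: R_def)
    have "card {x \<in> ?N. v \<in> ?B x} \<le> (\<Sum>i\<in>I. card {x \<in> N i. v \<in> B i x})"
      using card_graft_occurrences_le[where v = v and R = R and B = B, OF finI finN] False by simp
    \<comment> \<open>A vertex outside \<open>R\<close> occurs only in the child of its own
      colour.\<close>
    also have "\<dots> = (\<Sum>i\<in>{col v}. card {x \<in> N i. v \<in> B i x})"
    proof (rule sum.mono_neutral_right)
      show "\<forall>i\<in>I - {col v}. card {x \<in> N i. v \<in> B i x} = 0"
      proof
        fix i assume "i \<in> I - {col v}"
        then show "card {x \<in> N i. v \<in> B i x} = 0"
          using V'_col[OF _ \<open>v \<notin> X\<close>, of i] by (intro outside) blast+
      qed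
    qed (use finI i in simp_all)
    also have "\<dots> \<le> card (E' (col v) `` {v}) + 1"
      using spread[OF i] False by simp
    also have "card (E' (col v) `` {v}) \<le> card (E `` {v})"
      using finE E'E by (intro card_mono finite_Image) auto
    finally show ?thesis
      using \<open>v \<notin> S\<close> by simp
  qed
  ultimately show ?case
    by blast
qed

section \<open>Return to trees on natural numbers\<close>

text \<open>The bijection \<open>list_encode\<close> carries \<open>butlast\<close> to a parent map
  with list length as rank. The node \<open>t\<close> closest to the root is exactly the top that
  \<open>parent_connected\<close> asks for.\<close>

lemma list_decomposition_tree_decomposition:
  fixes G :: "'a pair_pre_digraph"
  assumes "list_decomposition (pverts G) (parcs G) N B"
  obtains T :: "nat pair_pre_digraph" where "pverts T = list_encode ` N"
    "tree_decomposition G T (B \<circ> list_decode)"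
proof -
  have N: "finite N" "[] \<in> N" "\<forall>x\<in>N. x \<noteq> [] \<longrightarrow> butlast x \<in> N"
    and sub: "\<forall>x\<in>N. B x \<subseteq> pverts G"
    and edge: "\<forall>u w. (u, w) \<in> parcs G \<longrightarrow> (\<exists>x\<in>N. u \<in> B x \<and> w \<in> B x)"
    and top: "\<forall>v\<in>pverts G. \<exists>t\<in>N. v \<in> B t \<and>
      (\<forall>x\<in>N. v \<in> B x \<longrightarrow> x \<noteq> t \<longrightarrow> x \<noteq> [] \<and> v \<in> B (butlast x))"
    using assms unfolding list_decomposition_def by blast+
  define M where "M = list_encode ` N"
  define r where "r = list_encode []"
  define par where "par = list_encode \<circ> butlast \<circ> list_decode"
  define T where "T = \<lparr>pverts = M, parcs = (\<Union>x\<in>M - {r}. {(x, par x), (par x, x)})\<rparr>"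
  have M: "finite M" "r \<in> M"
    unfolding M_def r_def using N(1) imageI[OF N(2), of list_encode] by blast+
  have par: "par x \<in> M \<and> length (list_decode (par x)) < length (list_decode x)"
    if "x \<in> M" "x \<noteq> r" for x
  proof -
    obtain y where "x = list_encode y" "y \<in> N"
      using \<open>x \<in> M\<close> by (auto simp: M_def)
    moreover from this have "y \<noteq> []"
      using \<open>x \<noteq> r\<close> by (auto simp: r_def)
    ultimately show ?thesis
      using N(3) by (auto simp: M_def par_def)
  qed
  have "undirected_tree T"
    unfolding T_def using M par by (rule parent_tree)
  moreover have "Digraph_Component.connected (with_proj T \<restriction> {x \<in> pverts T. v \<in> (B \<circ> list_decode) x})"
    if v: "v \<in> pverts G" for v
  proof -
    obtain t where t: "t \<in> N" "v \<in> B t"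
      "\<forall>x\<in>N. v \<in> B x \<longrightarrow> x \<noteq> t \<longrightarrow> x \<noteq> [] \<and> v \<in> B (butlast x)"
      using top v by blast
    have "Digraph_Component.connected (with_proj T \<restriction> {x \<in> M. v \<in> B (list_decode x)})"
      unfolding T_def
    proof (rule parent_connected[where rank = "length \<circ> list_decode" and t = "list_encode t"])
      show "x \<noteq> r \<and> par x \<in> {x \<in> M. v \<in> B (list_decode x)}"
        if x: "x \<in> {x \<in> M. v \<in> B (list_decode x)}" "x \<noteq> list_encode t" for x
      proof -
        obtain y where y: "x = list_encode y" "y \<in> N"
          using x(1) by (auto simp: M_def)
        then have "v \<in> B y" "y \<noteq> t"
          using x by auto
        then have "y \<noteq> []" "v \<in> B (butlast y)" "butlast y \<in> N"
          using y(2) t(3) N(3) by blast+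
        moreover from this have "x \<noteq> r"
          unfolding y(1) r_def list_encode_eq by blast
        ultimately show ?thesis
          using y(1) by (simp add: M_def par_def)
      qed
    qed (use M par t in \<open>auto simp: M_def\<close>)
    then show ?thesis
      by (simp add: T_def)
  qed
  ultimately have "tree_decomposition G T (B \<circ> list_decode)"
    using sub edge by (auto simp: tree_decomposition_def T_def M_def)
  moreover have "pverts T = list_encode ` N"
    by (simp add: T_def M_def)
  ultimately show thesis
    using that by blast
qed

theorem theorem2:
  fixes G :: "'a pair_pre_digraph" and k :: nat
  assumes "pair_graph G"
    and "treewidth G = int k"
  shows "\<exists>(T :: nat pair_pre_digraph) B. tree_decomposition G T B \<and>
           width T B \<le> 14 * int k + 13 \<and>
           (\<forall>v\<in>pverts G. spread T B v \<le> vert_degree G v + 1)"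
proof -
  interpret G: pair_graph G by fact
  obtain T\<^sub>0 :: "nat pair_pre_digraph" and B\<^sub>0 where dec\<^sub>0: "tree_decomposition G T\<^sub>0 B\<^sub>0" "width T\<^sub>0 B\<^sub>0 = int k"
    using treewidth_attained[OF assms(1)] assms(2) by auto
  then interpret T\<^sub>0: pair_graph T\<^sub>0
    by (simp add: tree_decomposition_def undirected_tree_def)
  have "card (B\<^sub>0 x) \<le> k + 1" if "x \<in> pverts T\<^sub>0" for x
  proof -
    have "card (B\<^sub>0 x) \<le> Max ((\<lambda>x. card (B\<^sub>0 x)) ` pverts T\<^sub>0)"
      using that T\<^sub>0.pair_finite_verts by (intro Max_ge) auto
    then show ?thesis
      using dec\<^sub>0(2) by (simp add: width_def)
  qed
  then have sep: "balanced_separators (2 * (k + 1)) (pverts G) (parcs G)"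
    by (rule tree_decomposition_balanced_separators[OF assms(1) dec\<^sub>0(1)])
  \<comment> \<open>With \<open>S = {}\<close> the conditions on \<open>S\<close> are vacuous and
    every vertex gets the bound degree plus 1. The bag size \<open>7 * (2 * (k + 1))\<close> equals
    \<open>14 * k + 14\<close>, one more than the width.\<close>
  have "\<exists>N B. list_decomposition (pverts G) (parcs G) N B \<and> {} \<subseteq> B [] \<and>
    (\<forall>x\<in>N. card (B x) \<le> 7 * (2 * (k + 1))) \<and>
    (\<forall>v\<in>pverts G. card {x \<in> N. v \<in> B x} + (if v \<in> {} then 1 else 0) \<le> card (parcs G `` {v}) + 1)"
  proof (rule low_spread_decomposition[OF _ _ _ sep])
    show "parcs G \<subseteq> pverts G \<times> pverts G"
      using G.in_arcsD1 G.in_arcsD2 by auto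
    show "sym (parcs G)"
      using G.arcs_symmetric by (auto simp: sym_def)
  qed (simp_all add: G.pair_finite_verts)
  then obtain N B where dec: "list_decomposition (pverts G) (parcs G) N B"
    and size: "\<forall>x\<in>N. card (B x) \<le> 7 * (2 * (k + 1))"
    and spread: "\<forall>v\<in>pverts G. card {x \<in> N. v \<in> B x} + (if v \<in> {} then 1 else 0) \<le>
      card (parcs G `` {v}) + 1"
    by meson
  obtain T :: "nat pair_pre_digraph" where T: "pverts T = list_encode ` N"
    "tree_decomposition G T (B \<circ> list_decode)"
    using dec by (rule list_decomposition_tree_decomposition)
  have "finite N" "N \<noteq> {}"
    using dec by (auto simp: list_decomposition_def)
  then have "Max ((\<lambda>x. card ((B \<circ> list_decode) x)) ` pverts T) \<le> 14 * k + 14"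
    using size by (auto simp: T(1))
  then have "width T (B \<circ> list_decode) \<le> 14 * int k + 13"
    by (simp add: width_def)
  moreover have "spread T (B \<circ> list_decode) v \<le> vert_degree G v + 1" if "v \<in> pverts G" for v
  proof -
    have "{x \<in> pverts T. v \<in> (B \<circ> list_decode) x} = list_encode ` {x \<in> N. v \<in> B x}"
      by (auto simp: T(1))
    then have "spread T (B \<circ> list_decode) v = card {x \<in> N. v \<in> B x}"
      by (simp add: spread_def card_image inj_on_def list_encode_eq)
    moreover have "out_arcs (with_proj G) v = Pair v ` (parcs G `` {v})"
      by (auto simp: out_arcs_def)
    then have "vert_degree G v = card (parcs G `` {v})"
      by (simp add: out_degree_def card_image inj_on_def)
    ultimately show ?thesis
      using spread that by simp
  qed
  ultimately show ?thesis
    using T(2) by blast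
qed

end
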